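(* For every $\epsilon > 0$ there is a constant $C_\epsilon > 0$, depending only on $\epsilon$, such that the following holds. Let $0 < \alpha \le 1$, let $n \ge 1$, and let $x = (x_1, \ldots, x_n)$ and $y = (y_1, \ldots, y_n)$ be $n$-tuples of distinct points of $[0,1]$ such that $\delta_H(x,[0,1]) \leq \alpha$ and such that $x$ and $y$ are weakly isotonic. Then there exists a similarity $A$ of $\mathbb{R}$ (which can be chosen independently of $\epsilon$) such that $$d_\infty(x, Ay) \le C_\epsilon\, \alpha^{1-\epsilon} \quad \text{for all } \epsilon > 0.$$
   Context: All distances are the usual distance on $\mathbb{R}$. An $n$-tuple of distinct points is also regarded as a finite set. Weakly isotonic: $n$-tuples $x=(x_1,\ldots,x_n)$ and $y=(y_1,\ldots,y_n)$ are weakly isotonic if for all $i,j,k \in \{1,\ldots,n\}$ one has $|x_i - x_j| < |x_i - x_k|$ if and only if $|y_i - y_j| < |y_i - y_k|$. $\delta_H(x,[0,1])$ is the smallest $a$ such that every point of $[0,1]$ is within distance $a$ of some point $x_i$. A similarity of $\mathbb{R}$ is a homeomorphism $A:\mathbb{R}\to\mathbb{R}$ that multiplies all distances by a (positive) scalar, i.e. a map $z \mapsto \lambda z + b$ with $\lambda \neq 0$. $Ay$ denotes $(Ay_1,\ldots,Ay_n)$. $d_\infty(x,z) = \max_{1\le i\le n} |x_i - z_i|$. *)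

theory Defs
  imports "HOL-Analysis.Analysis"
begin

text \<open>
  An \<open>n\<close>-tuple of points of the real line is a function \<open>nat \<Rightarrow> real\<close> of which only the values at
  the indices \<open>1, \<dots>, n\<close> are used; the length \<open>n\<close> is passed explicitly.
\<close>

definition weakly_isotonic :: "nat \<Rightarrow> (nat \<Rightarrow> real) \<Rightarrow> (nat \<Rightarrow> real) \<Rightarrow> bool" where
  "weakly_isotonic n x y \<longleftrightarrow>
     (\<forall>i\<in>{1..n}. \<forall>j\<in>{1..n}. \<forall>k\<in>{1..n}.
        dist (x i) (x j) < dist (x i) (x k) \<longleftrightarrow> dist (y i) (y j) < dist (y i) (y k))"

text \<open>
  \<open>\<delta>\<^sub>H(x, [0,1])\<close>. The least element exists whenever \<open>n \<ge> 1\<close>, see \<open>delta_H_least\<close> below.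
\<close>

definition delta_H :: "nat \<Rightarrow> (nat \<Rightarrow> real) \<Rightarrow> real" where
  "delta_H n x = (LEAST a. \<forall>t\<in>{0..1}. \<exists>i\<in>{1..n}. dist t (x i) \<le> a)"

definition similarity :: "(real \<Rightarrow> real) \<Rightarrow> bool" where
  "similarity A \<longleftrightarrow>
     (\<exists>B. homeomorphism UNIV UNIV A B) \<and> (\<exists>c>0. \<forall>u v. dist (A u) (A v) = c * dist u v)"

definition d_inf :: "nat \<Rightarrow> (nat \<Rightarrow> real) \<Rightarrow> (nat \<Rightarrow> real) \<Rightarrow> real" where
  "d_inf n x z = Max ((\<lambda>i. dist (x i) (z i)) ` {1..n})"

lemma delta_H_least:
  assumes "n \<ge> 1"
  shows "\<forall>t\<in>{0..1}. \<exists>i\<in>{1..n}. dist t (x i) \<le> delta_H n x"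
    and "\<And>a. \<forall>t\<in>{0..1}. \<exists>i\<in>{1..n}. dist t (x i) \<le> a \<Longrightarrow> delta_H n x \<le> a"
proof -
  let ?X = "x ` {1..n}"
  let ?P = "\<lambda>a. \<forall>t\<in>{0..1}. \<exists>i\<in>{1..n}. dist t (x i) \<le> a"
  have ne: "?X \<noteq> {}" and cl: "closed ?X"
    using assms by (auto intro: finite_imp_closed)
  have iff: "(\<exists>i\<in>{1..n}. dist t (x i) \<le> a) \<longleftrightarrow> infdist t ?X \<le> a" for t a
  proof
    assume "\<exists>i\<in>{1..n}. dist t (x i) \<le> a"
    then show "infdist t ?X \<le> a"
      by (metis image_eqI infdist_le2)
  next
    assume le: "infdist t ?X \<le> a"
    obtain z where "z \<in> ?X" "infdist t ?X = dist t z"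
      using infdist_attains_inf[OF cl ne] by blast
    with le show "\<exists>i\<in>{1..n}. dist t (x i) \<le> a" by auto
  qed
  have "continuous_on {0..1::real} (\<lambda>t. infdist t ?X)"
    by (intro continuous_intros)
  then obtain s where s: "s \<in> {0..1}" "\<forall>t\<in>{0..1}. infdist t ?X \<le> infdist s ?X"
    using continuous_attains_sup[of "{0..1::real}" "\<lambda>t. infdist t ?X"] by auto
  have P: "?P a \<longleftrightarrow> infdist s ?X \<le> a" for a
    using s unfolding iff by force
  have eq: "delta_H n x = infdist s ?X"
    unfolding delta_H_def P by (rule Least_equality) auto
  show "?P (delta_H n x)" unfolding P eq by simp
  show "delta_H n x \<le> a" if "?P a" for a using that unfolding P eq .
qed

lemma similarity_iff_affine: "similarity A \<longleftrightarrow> (\<exists>l b. l \<noteq> 0 \<and> A = (\<lambda>z. l * z + b))"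
proof
  assume "similarity A"
  then obtain c where c: "c > 0" "\<And>u v. \<bar>A u - A v\<bar> = c * \<bar>u - v\<bar>"
    by (auto simp: similarity_def dist_real_def)
  define l where "l = A 1 - A 0"
  have l: "\<bar>l\<bar> = c" using c(2)[of 1 0] by (simp add: l_def)
  have "A z = l * z + A 0" for z
  proof -
    have "(A z - A 0)\<^sup>2 = c\<^sup>2 * z\<^sup>2" "(A z - A 1)\<^sup>2 = c\<^sup>2 * (z - 1)\<^sup>2"
      using c(2)[of z 0] c(2)[of z 1] by (metis diff_zero power2_abs power_mult_distrib)+
    moreover have "l\<^sup>2 = c\<^sup>2" using l by (metis power2_abs)
    ultimately have "2 * l * (A z - A 0 - l * z) = 0"
      unfolding l_def by (simp add: power2_eq_square) algebra
    with l c(1) show ?thesis by auto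
  qed
  moreover have "l \<noteq> 0" using l c(1) by auto
  ultimately show "\<exists>l b. l \<noteq> 0 \<and> A = (\<lambda>z. l * z + b)" by blast
next
  assume "\<exists>l b. l \<noteq> 0 \<and> A = (\<lambda>z. l * z + b)"
  then obtain l b where l: "l \<noteq> 0" and A: "A = (\<lambda>z. l * z + b)" by blast
  have "homeomorphism UNIV UNIV A (\<lambda>z. (z - b) / l)"
    unfolding A by (rule homeomorphismI) (use l in \<open>auto intro!: continuous_intros\<close>)
  moreover have "dist (A u) (A v) = \<bar>l\<bar> * dist u v" for u v
    by (simp add: A dist_real_def flip: abs_mult right_diff_distrib)
  ultimately show "similarity A"
    unfolding similarity_def using l by (metis zero_less_abs_iff)
qed

end

theory Submission
  imports Defs
begin

text \<open>
  Let \<open>A\<close> be the affine map that makes \<open>x\<close> and \<open>v = A \<circ> y\<close> agree at the indices \<open>p\<close>, \<open>q\<close> of the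
  extreme points of \<open>x\<close>, and let \<open>M\<close> be the largest value of \<open>\<bar>x\<^sub>i - v\<^sub>i\<bar>\<close>. If \<open>x\<^sub>i\<close> lies in the left
  half, reflect \<open>x\<^sub>p\<close> in \<open>x\<^sub>i\<close> and choose points \<open>x\<^sub>j\<close>, \<open>x\<^sub>k\<close> just below and just above the
  reflection. Isotonicity gives \<open>v\<^sub>j - v\<^sub>i \<le> v\<^sub>i - v\<^sub>p \<le> v\<^sub>k - v\<^sub>i\<close>, hence
  \<open>\<bar>x\<^sub>i - v\<^sub>i\<bar> \<le> M / 2 + \<alpha>\<close>; the right half is symmetric. Thus \<open>M \<le> 2 * \<alpha>\<close>,
  and \<open>C \<epsilon> = 2\<close> works for every \<open>\<epsilon>\<close> because \<open>\<alpha> \<le> 1\<close>.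
\<close>

lemma weakly_isotonicD:
  assumes "weakly_isotonic n x y" "i \<in> {1..n}" "j \<in> {1..n}" "k \<in> {1..n}"
  shows "\<bar>x i - x j\<bar> < \<bar>x i - x k\<bar> \<longleftrightarrow> \<bar>y i - y j\<bar> < \<bar>y i - y k\<bar>"
  using assms unfolding weakly_isotonic_def dist_real_def by blast

lemma weakly_isotonic_affine:
  assumes "weakly_isotonic n x y" "k \<noteq> 0" "l \<noteq> 0"
  shows "weakly_isotonic n (\<lambda>i. k * x i + a) (\<lambda>i. l * y i + b)"
proof -
  have "dist (c * u + d) (c * v + d) = \<bar>c\<bar> * dist u v" for c d u v :: real
    by (simp add: dist_real_def flip: abs_mult right_diff_distrib)
  with assms show ?thesis by (simp add: weakly_isotonic_def)
qed

text \<open>A strictly intermediate point is closer to each end than the ends are to each other.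
  Isotonicity carries over both comparisons, which on the line force betweenness. Only distances are
  compared, so the orientation stays open.\<close>

lemma weakly_isotonic_between:
  assumes "weakly_isotonic n x y" "i \<in> {1..n}" "j \<in> {1..n}" "k \<in> {1..n}"
    and "x i \<le> x j" "x j \<le> x k" "inj_on x {1..n}"
  shows "y i \<le> y j \<and> y j \<le> y k \<or> y k \<le> y j \<and> y j \<le> y i"
proof (cases "i = j \<or> j = k")
  case True
  then show ?thesis by auto
next
  case False
  then have "x i \<noteq> x j" "x j \<noteq> x k"
    using inj_onD[OF assms(7)] assms(2-4) by blast+
  then have "x i < x j" "x j < x k"
    using assms(5,6) by linarith+
  then have "\<bar>x i - x j\<bar> < \<bar>x i - x k\<bar>" "\<bar>x k - x j\<bar> < \<bar>x k - x i\<bar>"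
    by linarith+
  then have "\<bar>y i - y j\<bar> < \<bar>y i - y k\<bar>" "\<bar>y k - y j\<bar> < \<bar>y k - y i\<bar>"
    using weakly_isotonicD[OF assms(1)] assms(2-4) by blast+
  then show ?thesis by linarith
qed

lemma left_half_bound:
  assumes iso: "weakly_isotonic n x v"
    and inj: "inj_on x {1..n}" and x01: "x ` {1..n} \<subseteq> {0..1}"
    and cover: "\<And>t. t \<in> {0..1} \<Longrightarrow> \<exists>i\<in>{1..n}. \<bar>t - x i\<bar> \<le> \<alpha>"
    and p: "p \<in> {1..n}" "v p = x p" and q: "q \<in> {1..n}" "v q = x q"
    and ends: "\<And>i. i \<in> {1..n} \<Longrightarrow> x p \<le> x i \<and> x i \<le> x q"
    and M: "\<And>i. i \<in> {1..n} \<Longrightarrow> \<bar>x i - v i\<bar> \<le> M"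
    and i: "i \<in> {1..n}" "2 * x i \<le> x p + x q"
  shows "\<bar>x i - v i\<bar> \<le> M / 2 + \<alpha>"
proof -
  have range: "0 \<le> x r" "x r \<le> 1" if "r \<in> {1..n}" for r
    using subsetD[OF x01 imageI[OF that]] by simp_all
  \<comment> \<open>Agreement with \<open>x\<close> at \<open>p\<close> and \<open>q\<close> settles
    the orientation: \<open>v p \<le> v q\<close>.\<close>
  have vp: "v p \<le> v r" if "r \<in> {1..n}" for r
    using weakly_isotonic_between[OF iso p(1) that q(1)] ends[OF that] p q inj by auto
  define t where "t = 2 * x i - x p"
  have t: "x i \<le> t" "x p \<le> t" "t \<le> x q" "0 \<le> t" "t \<le> 1"
    using ends[OF i(1)] i(2) range[OF p(1)] range[OF q(1)] by (auto simp: t_def)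
  \<comment> \<open>Covering \<open>t - \<alpha>\<close> instead of \<open>t\<close> keeps the point
    on the lower side of \<open>t\<close>, at the price of \<open>2 * \<alpha>\<close>. If
    \<open>t - \<alpha>\<close> leaves the unit interval, \<open>p\<close> itself is close
    enough.\<close>
  obtain j where j: "j \<in> {1..n}" "x j \<le> t" "t - 2 * \<alpha> \<le> x j"
  proof (cases "\<alpha> \<le> t")
    case True
    then obtain j where "j \<in> {1..n}" "\<bar>t - \<alpha> - x j\<bar> \<le> \<alpha>"
      using cover[of "t - \<alpha>"] cover[of t] t by fastforce
    with that[of j] show ?thesis by (simp add: abs_le_iff)
  next
    case False
    with that[of p] p t range[OF p(1)] show ?thesis by simp
  qed
  obtain k where k: "k \<in> {1..n}" "t \<le> x k" "x k \<le> t + 2 * \<alpha>"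
  proof (cases "t + \<alpha> \<le> 1")
    case True
    then obtain k where "k \<in> {1..n}" "\<bar>t + \<alpha> - x k\<bar> \<le> \<alpha>"
      using cover[of "t + \<alpha>"] cover[of t] t by fastforce
    with that[of k] show ?thesis by (simp add: abs_le_iff)
  next
    case False
    with that[of q] q t range[OF q(1)] show ?thesis by simp
  qed
  have "\<bar>v i - v j\<bar> \<le> \<bar>v i - v p\<bar>" if "x i \<le> x j"
    using weakly_isotonicD[OF iso i(1) p(1) j(1)] that j(2) ends[OF i(1)] by (auto simp: t_def)
  \<comment> \<open>When \<open>t\<close> is near \<open>x i\<close>, the point \<open>x j\<close>
    may fall to the left of \<open>x i\<close>; then order alone suffices.\<close>
  moreover have "v j \<le> v i" if "x j \<le> x i"
    using weakly_isotonic_between[OF iso p(1) j(1) i(1)] that ends[OF j(1)]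
      vp[OF j(1)] vp[OF i(1)] inj
    by auto
  ultimately have lower: "v j + v p \<le> 2 * v i"
    using vp[OF i(1)] vp[OF j(1)] by linarith
  have "v i \<le> v k"
    using weakly_isotonic_between[OF iso p(1) i(1) k(1)] ends[OF i(1)] t k(2)
      vp[OF i(1)] vp[OF k(1)] inj
    by auto
  moreover have "\<bar>v i - v p\<bar> \<le> \<bar>v i - v k\<bar>"
    using weakly_isotonicD[OF iso i(1) k(1) p(1)] k(2) ends[OF i(1)] by (auto simp: t_def)
  ultimately have upper: "2 * v i \<le> v k + v p" by linarith
  \<comment> \<open>The anchor \<open>p\<close> carries no error, so \<open>2 * v i\<close> differs
    from \<open>2 * x i = t + x p\<close> by at most \<open>M + 2 * \<alpha>\<close>; halving gives
    the bound.\<close>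
  show ?thesis
    using lower upper M[OF j(1)] M[OF k(1)] j(3) k(3) p(2) unfolding t_def abs_le_iff by argo
qed

lemma anchored_bound:
  assumes iso: "weakly_isotonic n x v"
    and inj: "inj_on x {1..n}" and x01: "x ` {1..n} \<subseteq> {0..1}"
    and cover: "\<And>t. t \<in> {0..1} \<Longrightarrow> \<exists>i\<in>{1..n}. \<bar>t - x i\<bar> \<le> \<alpha>"
    and p: "p \<in> {1..n}" "v p = x p" and q: "q \<in> {1..n}" "v q = x q"
    and ends: "\<And>i. i \<in> {1..n} \<Longrightarrow> x p \<le> x i \<and> x i \<le> x q"
  shows "d_inf n x v \<le> 2 * \<alpha>"
proof -
  let ?M = "d_inf n x v" and ?D = "(\<lambda>i. dist (x i) (v i)) ` {1..n}"
  have M: "\<bar>x i - v i\<bar> \<le> ?M" if "i \<in> {1..n}" for i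
    using that unfolding d_inf_def dist_real_def[symmetric] by (intro Max_ge) auto
  have "?M \<in> ?D"
    unfolding d_inf_def using p(1) by (intro Max_in) auto
  then obtain i where i: "i \<in> {1..n}" "?M = \<bar>x i - v i\<bar>" by (auto simp: dist_real_def)
  have "\<bar>x i - v i\<bar> \<le> ?M / 2 + \<alpha>"
  proof (cases "2 * x i \<le> x p + x q")
    case True
    show ?thesis
      by (rule left_half_bound[OF iso inj x01 cover p q ends M i(1) True])
  next
    case False
    \<comment> \<open>The reflection of the unit interval swaps the anchors and moves
      \<open>x i\<close> to the left half.\<close>
    have "\<bar>(1 - x i) - (1 - v i)\<bar> \<le> ?M / 2 + \<alpha>"
    proof (rule left_half_bound[where n = n and p = q and q = p
          and x = "\<lambda>i. 1 - x i" and v = "\<lambda>i. 1 - v i"])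
      show "weakly_isotonic n (\<lambda>i. 1 - x i) (\<lambda>i. 1 - v i)"
        using weakly_isotonic_affine[OF iso, of "-1" "-1" 1 1] by simp
      show "\<exists>i\<in>{1..n}. \<bar>t - (1 - x i)\<bar> \<le> \<alpha>" if "t \<in> {0..1}" for t
      proof -
        have "1 - t \<in> {0..1}" using that by auto
        from cover[OF this] show ?thesis by (simp add: abs_le_iff algebra_simps conj_commute)
      qed
      show "\<bar>(1 - x i) - (1 - v i)\<bar> \<le> ?M" if "i \<in> {1..n}" for i
        using M[OF that] by simp
      show "1 - x q \<le> 1 - x i \<and> 1 - x i \<le> 1 - x p" if "i \<in> {1..n}" for i
        using ends[OF that] by simp
      show "inj_on (\<lambda>i. 1 - x i) {1..n}"
        using inj_onD[OF inj] by (intro inj_onI) simp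
      show "(\<lambda>i. 1 - x i) ` {1..n} \<subseteq> {0..1}"
        using x01 by auto
      show "2 * (1 - x i) \<le> 1 - x q + (1 - x p)"
        using False by (simp add: algebra_simps)
    qed (use p q i(1) in simp_all)
    then show ?thesis by simp
  qed
  with i(2) show ?thesis by simp
qed

lemma weakly_isotonic_approx:
  assumes "n \<ge> 1" and inj: "inj_on x {1..n}" "inj_on y {1..n}"
    and x01: "x ` {1..n} \<subseteq> {0..1}"
    and \<alpha>: "delta_H n x \<le> \<alpha>" and iso: "weakly_isotonic n x y"
  shows "\<exists>A. similarity A \<and> d_inf n x (\<lambda>i. A (y i)) \<le> 2 * \<alpha>"
proof -
  have cover: "\<exists>i\<in>{1..n}. \<bar>t - x i\<bar> \<le> \<alpha>" if "t \<in> {0..1}" for t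
    using delta_H_least(1)[OF assms(1), of x] that \<alpha>
    unfolding dist_real_def by (meson order_trans)
  have fin: "finite (x ` {1..n})" "x ` {1..n} \<noteq> {}" using assms(1) by auto
  obtain p where p: "p \<in> {1..n}" "x p = Min (x ` {1..n})" using Min_in[OF fin] by auto
  obtain q where q: "q \<in> {1..n}" "x q = Max (x ` {1..n})" using Max_in[OF fin] by auto
  have ends: "x p \<le> x i \<and> x i \<le> x q" if "i \<in> {1..n}" for i
    using that p q fin by auto
  obtain l b where l: "l \<noteq> 0" "l * y p + b = x p" "l * y q + b = x q"
  proof (cases "p = q")
    case True
    with that[of 1 "x p - y p"] show ?thesis by simp
  next
    case False
    \<comment> \<open>The slope of the line through the two anchor pairs; it is negative when
      \<open>y\<close> reverses the order.\<close>
    define l where "l = (x q - x p) / (y q - y p)"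
    have ne: "x p \<noteq> x q" "y p \<noteq> y q" using inj[THEN inj_onD] p(1) q(1) False by blast+
    then have "l * (y q - y p) = x q - x p" by (simp add: l_def)
    then have "l * y q + (x p - l * y p) = x q" by (simp add: algebra_simps)
    with that[of l "x p - l * y p"] ne show ?thesis by (simp add: l_def)
  qed
  have "d_inf n x (\<lambda>i. l * y i + b) \<le> 2 * \<alpha>"
  proof (rule anchored_bound[OF _ inj(1) x01 cover p(1) l(2) q(1) l(3) ends])
    show "weakly_isotonic n x (\<lambda>i. l * y i + b)"
      using weakly_isotonic_affine[OF iso, of 1 l 0 b] l(1) by simp
  qed
  with l(1) show ?thesis
    by (intro exI[of _ "\<lambda>z. l * z + b"]) (auto simp: similarity_iff_affine)
qed

theorem proposition1:
  "\<exists>C :: real \<Rightarrow> real. (\<forall>\<epsilon>>0. C \<epsilon> > 0) \<and>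
     (\<forall>(\<alpha>::real) (n::nat) (x :: nat \<Rightarrow> real) (y :: nat \<Rightarrow> real).
        0 < \<alpha> \<and> \<alpha> \<le> 1 \<and> n \<ge> 1 \<and>
        inj_on x {1..n} \<and> x ` {1..n} \<subseteq> {0..1} \<and>
        inj_on y {1..n} \<and> y ` {1..n} \<subseteq> {0..1} \<and>
        delta_H n x \<le> \<alpha> \<and> weakly_isotonic n x y \<longrightarrow>
        (\<exists>A. similarity A \<and>
          (\<forall>\<epsilon>>0. d_inf n x (\<lambda>i. A (y i)) \<le> C \<epsilon> * \<alpha> powr (1 - \<epsilon>))))"
proof (rule exI[of _ "\<lambda>_. 2"], intro conjI allI impI)
  fix \<alpha> :: real and n :: nat and x y :: "nat \<Rightarrow> real"
  assume H: "0 < \<alpha> \<and> \<alpha> \<le> 1 \<and> n \<ge> 1 \<and>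
        inj_on x {1..n} \<and> x ` {1..n} \<subseteq> {0..1} \<and>
        inj_on y {1..n} \<and> y ` {1..n} \<subseteq> {0..1} \<and>
        delta_H n x \<le> \<alpha> \<and> weakly_isotonic n x y"
  have le: "\<alpha> \<le> \<alpha> powr (1 - \<epsilon>)" if "\<epsilon> > 0" for \<epsilon>
    using powr_mono'[of "1 - \<epsilon>" 1 \<alpha>] H that by simp
  \<comment> \<open>\<open>A\<close> is fixed before any \<open>\<epsilon>\<close>, so it is
    independent of it.\<close>
  obtain A where A: "similarity A" "d_inf n x (\<lambda>i. A (y i)) \<le> 2 * \<alpha>"
    using weakly_isotonic_approx[of n x y \<alpha>] H by blast
  have "d_inf n x (\<lambda>i. A (y i)) \<le> 2 * \<alpha> powr (1 - \<epsilon>)" if "\<epsilon> > 0" for \<epsilon>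
    using A(2) le[OF that] by linarith
  with A(1) show "\<exists>A. similarity A \<and>
      (\<forall>\<epsilon>>0. d_inf n x (\<lambda>i. A (y i)) \<le> 2 * \<alpha> powr (1 - \<epsilon>))" by blast
qed simp

end
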